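(* The golden ratio $\alpha=\frac{\sqrt5+1}{2}$ is the smallest among all constants $\delta$ with the following property: for every stochastic vector $\vec a=(a_n)_{n\ge1}$, with associated interval partition points $(b_n)_{n\ge0}$ and monotonic rearrangement points $(b_n^* )_{n\ge0}$, and for every integer $n\ge1$ there is an integer $m\ge0$ such that $$\delta^{-1} b_m^*<b_n<\delta\, b_m^*.$$
   Context: A stochastic vector is a sequence $\vec a=(a_n)_{n\ge1}$ with $a_n>0$ and $\sum_{n\ge1}a_n=1$. The interval partition of $(0,1]$ with stochastic vector $\vec a$ has points $1=b_0>b_1>b_2>\dots$, $b_n\to0$, where $b_{n-1}-b_n=a_n$, i.e. $b_n=\sum_{k>n}a_k$ (its atoms are the intervals $(b_n,b_{n-1}]$). $\vec a^{\,*}=(a_n^* )$ is the non-increasing rearrangement of $\vec a$ (the permutation of its coordinates into non-increasing order), and the monotonic rearrangement of the interval partition has points $b_n^*=\sum_{k>n}a_k^*$, $n\ge0$. *)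

theory Defs
  imports "HOL-Analysis.Infinite_Sum"
begin

text \<open>Sequences \<open>(a\<^sub>n)\<close> with \<open>n \<ge> 1\<close> are functions on \<^typ>\<open>nat\<close> whose value at \<open>0\<close> is irrelevant.\<close>

definition stochastic_vector :: "(nat \<Rightarrow> real) \<Rightarrow> bool" where
  "stochastic_vector a \<longleftrightarrow> (\<forall>n\<ge>1. a n > 0) \<and> (a has_sum 1) {1..}"

definition partition_point :: "(nat \<Rightarrow> real) \<Rightarrow> nat \<Rightarrow> real" where
  "partition_point a n = (\<Sum>\<^sub>\<infinity>k\<in>{n<..}. a k)"

definition nonincreasing_rearrangement :: "(nat \<Rightarrow> real) \<Rightarrow> (nat \<Rightarrow> real) \<Rightarrow> bool" where
  "nonincreasing_rearrangement a c \<longleftrightarrow>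
     (\<exists>\<pi>. bij_betw \<pi> {1..} {1..} \<and> (\<forall>n\<ge>1. c n = a (\<pi> n))) \<and> antimono_on {1..} c"

text \<open>A nonpositive \<open>\<delta>\<close> never satisfies the second inequality, since all partition points are
  positive; so \<open>\<delta>\<close> may range over all reals, and the value of \<open>inverse 0\<close> plays no role.\<close>

definition rearrangement_constant :: "real \<Rightarrow> bool" where
  "rearrangement_constant \<delta> \<longleftrightarrow>
     (\<forall>a c. stochastic_vector a \<longrightarrow> nonincreasing_rearrangement a c \<longrightarrow>
        (\<forall>n\<ge>1. \<exists>m. inverse \<delta> * partition_point c m < partition_point a n \<and>
                    partition_point a n < \<delta> * partition_point c m))"

text \<open>Every stochastic vector has a non-increasing rearrangement, so quantifying over all \<open>c\<close>
  above is not vacuous for any \<open>a\<close>.\<close>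

lemma nonincreasing_rearrangement_exists:
  assumes "stochastic_vector a"
  shows "\<exists>c. nonincreasing_rearrangement a c"
proof -
  have pos: "a n > 0" if "n \<ge> 1" for n
    using assms that by (auto simp: stochastic_vector_def)
  have summ: "a summable_on {1..}"
    using assms by (auto simp: stochastic_vector_def summable_on_def)
  define P where "P i = {j. j \<ge> 1 \<and> (a j > a i \<or> (a j = a i \<and> j < i))}" for i
  have fin_ge: "finite {j. j \<ge> 1 \<and> a j \<ge> e}" if "e > 0" for e
  proof (rule ccontr)
    assume inf: "infinite {j. j \<ge> 1 \<and> a j \<ge> e}" (is "infinite ?J")
    have "a summable_on ?J"
      using summ by (rule summable_on_subset_banach) auto
    then have "(\<lambda>_. e) summable_on ?J"
      by (rule summable_on_comparison_test) (use that in auto)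
    then show False
      using infsum_diverge_constant[OF inf, of e] that by simp
  qed
  have finP: "finite (P i)" if "i \<ge> 1" for i
    by (rule finite_subset[OF _ fin_ge[OF pos[OF that]]]) (auto simp: P_def)
  have tri: "i \<in> P j \<or> j \<in> P i" if "i \<ge> 1" "j \<ge> 1" "i \<noteq> j" for i j
    using that by (auto simp: P_def)
  have psub: "P i \<subset> P j" if "i \<in> P j" for i j
    using that by (auto simp: P_def)
  define r where "r i = Suc (card (P i))" for i
  have less: "r i < r j" if "i \<in> P j" "j \<ge> 1" for i j
    unfolding r_def using psub[OF that(1)] finP[OF that(2)] by (simp add: psubset_card_mono)
  have inj: "inj_on r {1..}"
    by (intro inj_onI) (metis atLeast_iff less less_irrefl tri)
  have down: "\<exists>i\<ge>1. r i = k" if "1 \<le> k" "k \<le> r j" "j \<ge> 1" for j k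
  proof -
    have "inj_on r (insert j (P j))"
      by (rule inj_on_subset[OF inj]) (use that in \<open>auto simp: P_def\<close>)
    then have "card (r ` insert j (P j)) = card (insert j (P j))"
      by (rule card_image)
    also have "\<dots> = r j"
      using finP[OF that(3)] by (simp add: r_def P_def)
    finally have c: "card (r ` insert j (P j)) = card {1..r j}" by simp
    have "r ` insert j (P j) \<subseteq> {1..r j}"
      using less[OF _ that(3)] by (force simp: r_def)
    then have "r ` insert j (P j) = {1..r j}"
      using c by (intro card_subset_eq) auto
    then have "k \<in> r ` insert j (P j)" using that by auto
    then show ?thesis using that by (auto simp: P_def)
  qed
  have surj: "r ` {1..} = {1..}"
  proof
    show "r ` {1..} \<subseteq> {1..}" by (auto simp: r_def)
    show "{1..} \<subseteq> r ` {1..}"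
    proof
      fix k :: nat assume k: "k \<in> {1..}"
      have "infinite (r ` {1..})"
        using inj finite_imageD infinite_Ici by blast
      then obtain j where "j \<ge> 1" "k \<le> r j"
        unfolding infinite_nat_iff_unbounded_le by auto
      then show "k \<in> r ` {1..}" using down[of k j] k by auto
    qed
  qed
  have bij: "bij_betw r {1..} {1..}"
    using inj surj by (simp add: bij_betw_def)
  define p where "p = inv_into {1..} r"
  have bp: "bij_betw p {1..} {1..}"
    unfolding p_def by (rule bij_betw_inv_into[OF bij])
  have "a (p n) \<le> a (p m)" if "1 \<le> m" "m \<le> n" for m n
  proof (rule ccontr)
    assume "\<not> ?thesis"
    moreover have p1: "p n \<ge> 1" "p m \<ge> 1"
      using bij_betwE[OF bp] that by auto
    ultimately have "p n \<in> P (p m)" by (auto simp: P_def)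
    then have "r (p n) < r (p m)" using less p1 by blast
    moreover have "r (p n) = n" "r (p m) = m"
      using that surj by (auto simp: p_def intro!: f_inv_into_f)
    ultimately show False using that by simp
  qed
  then have "nonincreasing_rearrangement a (a \<circ> p)"
    unfolding nonincreasing_rearrangement_def monotone_on_def using bp by auto
  then show ?thesis by blast
qed

end

theory Submission
  imports Defs
begin

text \<open>
  Write \<open>\<alpha>\<close> for the golden ratio, so that \<open>\<alpha> - 1/\<alpha> = 1\<close>, and fix \<open>n \<ge> 1\<close>. If no \<open>b\<^sub>m\<^sup>*\<close> lies
  strictly between \<open>b\<^sub>n / \<alpha>\<close> and \<open>\<alpha> b\<^sub>n\<close>, then the decreasing sequence \<open>b\<^sup>*\<close>, which runs from
  \<open>1 > b\<^sub>n\<close> to \<open>0\<close>, jumps over this whole window in a single step: \<open>b\<^sup>*\<close> at \<open>m - 1\<close> is at least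
  \<open>\<alpha> b\<^sub>n\<close> and \<open>b\<^sub>m\<^sup>* \<le> b\<^sub>n / \<alpha>\<close>. Hence \<open>a\<^sub>m\<^sup>* \<ge> (\<alpha> - 1/\<alpha>) b\<^sub>n = b\<^sub>n\<close>. Every entry of the tail
  \<open>k > n\<close> is smaller than the sum \<open>b\<^sub>n\<close> of that tail, so all of the tail is rearranged to places
  behind \<open>m\<close>, and therefore \<open>b\<^sub>n \<le> b\<^sub>m\<^sup>*\<close>
  (\<open>partition_point_le_rearranged\<close>), contradicting \<open>b\<^sub>m\<^sup>* \<le> b\<^sub>n / \<alpha> < b\<^sub>n\<close>.

  No smaller constant works, because the argument is tight when the tail consists of one entry of
  size almost \<open>b\<^sub>n\<close> and a negligible rest. Take \<open>n = 1\<close>, \<open>a\<^sub>1 = 1/\<alpha>\<^sup>2\<close>, and spread the remaining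
  mass \<open>1/\<alpha>\<close> geometrically with a tiny ratio \<open>\<epsilon>\<close> (\<open>golden_vector\<close>). Then \<open>b\<^sub>1 = 1/\<alpha>\<close>, while
  \<open>b\<^sub>0\<^sup>* = 1\<close> is too large by the factor \<open>\<alpha>\<close>, and all other \<open>b\<^sub>m\<^sup>*\<close> are at most
  \<open>1 - a\<^sub>2 = 1/\<alpha>\<^sup>2 + \<epsilon>/\<alpha>\<close>, too small by a factor that tends to \<open>\<alpha>\<close> as \<open>\<epsilon> \<rightarrow> 0\<close>.
\<close>

section \<open>Partition points of a stochastic vector\<close>

lemma stochastic_vector_summable_on:
  assumes "stochastic_vector a" "A \<subseteq> {1..}"
  shows "a summable_on A"
  using assms summable_on_subset_banach unfolding stochastic_vector_def summable_on_def
  by blast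

lemma bij_betw_Suc_positive: "bij_betw Suc UNIV {1..}"
  by (rule bij_betw_byWitness[where f' = "\<lambda>n. n - 1"]) auto

lemma stochastic_vector_sums:
  assumes "stochastic_vector a"
  shows "(\<lambda>k. a (Suc k)) sums 1"
proof -
  from has_sum_reindex_bij_betw[OF bij_betw_Suc_positive, of a 1] show ?thesis
    using assms by (intro has_sum_imp_sums) (simp add: stochastic_vector_def)
qed

lemma partition_point_eq:
  assumes "stochastic_vector a"
  shows "partition_point a n = 1 - (\<Sum>k<n. a (Suc k))"
proof -
  have "{1..} = {1..n} \<union> {n<..}" by auto
  then have "1 = infsum a ({1..n} \<union> {n<..})"
    using assms by (auto simp: stochastic_vector_def dest: infsumI)
  also have "\<dots> = infsum a {1..n} + partition_point a n"
    unfolding partition_point_def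
    using assms by (intro infsum_Un_disjoint stochastic_vector_summable_on) auto
  also have "infsum a {1..n} = (\<Sum>k<n. a (Suc k))"
    by (simp add: sum.atLeast1_atMost_eq)
  finally show ?thesis by simp
qed

lemma partition_point_0:
  "stochastic_vector a \<Longrightarrow> partition_point a 0 = 1"
  by (simp add: partition_point_eq)

lemma partition_point_Suc:
  "stochastic_vector a \<Longrightarrow> partition_point a (Suc n) = partition_point a n - a (Suc n)"
  by (simp add: partition_point_eq)

lemma partition_point_antimono:
  assumes "stochastic_vector a"
  shows "antimono (partition_point a)"
  using assms by (intro decseq_SucI)
    (auto simp: partition_point_Suc stochastic_vector_def intro: less_imp_le)

lemma partition_point_tendsto_0:
  assumes "stochastic_vector a"
  shows "partition_point a \<longlonglongrightarrow> 0"
  using tendsto_diff[OF tendsto_const[of "1::real"] stochastic_vector_sums[OF assms, unfolded sums_def]]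
  by (simp add: partition_point_eq[OF assms, abs_def])

lemma partition_point_nonneg:
  assumes "stochastic_vector a"
  shows "partition_point a n \<ge> 0"
  using decseq_ge[OF partition_point_antimono partition_point_tendsto_0] assms by blast

lemma partition_point_pos:
  assumes a: "stochastic_vector a"
  shows "partition_point a n > 0"
proof -
  have "a (Suc n) > 0" using a by (simp add: stochastic_vector_def)
  then show ?thesis
    using partition_point_Suc[OF a, of n] partition_point_nonneg[OF a, of "Suc n"] by linarith
qed

text \<open>Strictness comes from the infinitely many other positive terms of the tail.\<close>

lemma entry_less_partition_point:
  assumes a: "stochastic_vector a" and "n < k"
  shows "a k < partition_point a n"
proof -
  obtain j where k: "k = Suc j" and j: "n \<le> j" using \<open>n < k\<close> by (cases k) auto
  have "a k < partition_point a j"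
    using partition_point_Suc[OF a, of j] partition_point_pos[OF a, of k] k by simp
  also have "partition_point a j \<le> partition_point a n"
    using partition_point_antimono[OF a] j by (rule antimonoD)
  finally show ?thesis .
qed

section \<open>The golden ratio is a rearrangement constant\<close>

lemma stochastic_vector_rearrangement:
  assumes a: "stochastic_vector a" and "nonincreasing_rearrangement a c"
  shows "stochastic_vector c"
proof -
  obtain p where p: "bij_betw p {1..} {1..}" and c: "\<And>n. n \<ge> 1 \<Longrightarrow> c n = a (p n)"
    using assms(2) by (auto simp: nonincreasing_rearrangement_def)
  have "((\<lambda>n. a (p n)) has_sum 1) {1..}"
    using a has_sum_reindex_bij_betw[OF p, of a 1] by (simp add: stochastic_vector_def)
  then have "(c has_sum 1) {1..}"
    using c by (subst has_sum_cong[where g = "\<lambda>n. a (p n)"]) auto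
  then show ?thesis
    using a c bij_betwE[OF p] by (auto simp: stochastic_vector_def)
qed

text \<open>A non-increasing rearrangement moves all entries smaller than its \<open>m\<close>-th entry to places
  behind \<open>m\<close>, so their sum is part of the tail sum there.\<close>

lemma partition_point_le_rearranged:
  assumes a: "stochastic_vector a" and r: "nonincreasing_rearrangement a c"
    and m: "m \<ge> 1" and small: "\<And>k. k > n \<Longrightarrow> a k < c m"
  shows "partition_point a n \<le> partition_point c m"
proof -
  obtain p where p: "bij_betw p {1..} {1..}" and c: "\<And>n. n \<ge> 1 \<Longrightarrow> c n = a (p n)"
    and mono: "antimono_on {1..} c"
    using r by (auto simp: nonincreasing_rearrangement_def)
  have sub: "{n<..} \<subseteq> p ` {m<..}"
  proof
    fix k assume k: "k \<in> {n<..}"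
    then have "k \<in> p ` {1..}" using p by (auto simp: bij_betw_def)
    then obtain j where j: "j \<ge> 1" "k = p j" by auto
    then have "c j < c m" using small[of k] k c by simp
    then have "m < j" using monotone_onD[OF mono, of j m] m j by (meson atLeast_iff not_le)
    then show "k \<in> p ` {m<..}" using j by blast
  qed
  have img: "p ` {m<..} \<subseteq> {1..}"
    using bij_betwE[OF p] m by auto
  have "partition_point a n \<le> infsum a (p ` {m<..})"
    unfolding partition_point_def
  proof (rule infsum_mono2)
    show "a summable_on {n<..}" "a summable_on p ` {m<..}"
      using img by (intro stochastic_vector_summable_on[OF a]; force)+
    show "\<And>k. k \<in> p ` {m<..} - {n<..} \<Longrightarrow> 0 \<le> a k"
      using a img unfolding stochastic_vector_def by (meson DiffD1 atLeast_iff less_imp_le subsetD)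
  qed (rule sub)
  also have "inj_on p {m<..}"
    using p by (rule bij_betw_imp_inj_on[THEN inj_on_subset]) (use m in auto)
  then have "infsum a (p ` {m<..}) = infsum (a \<circ> p) {m<..}"
    by (rule infsum_reindex)
  also have "\<dots> = partition_point c m"
    unfolding partition_point_def using c m by (intro infsum_cong) auto
  finally show ?thesis .
qed

lemma golden_ratio_identities:
  fixes g :: real
  defines "g \<equiv> (sqrt 5 + 1) / 2"
  shows "g > 1" "inverse g = g - 1" "inverse (g\<^sup>2) = 1 - inverse g"
proof -
  have sq: "g\<^sup>2 = g + 1"
    unfolding g_def by (simp add: power2_eq_square field_simps)
  show g1: "g > 1"
    unfolding g_def using real_less_rsqrt[of 1 5] by simp
  show i: "inverse g = g - 1"
    using sq g1 by (simp add: field_simps power2_eq_square)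
  show "inverse (g\<^sup>2) = 1 - inverse g"
    using sq g1 by (simp add: field_simps power2_eq_square)
qed

lemma rearrangement_constant_golden_ratio:
  "rearrangement_constant ((sqrt 5 + 1) / 2)"
  unfolding rearrangement_constant_def
proof (intro allI impI)
  fix a c :: "nat \<Rightarrow> real" and n :: nat
  assume a: "stochastic_vector a" and r: "nonincreasing_rearrangement a c" and n: "n \<ge> 1"
  define g :: real where "g = (sqrt 5 + 1) / 2"
  have g: "g > 1" "inverse g = g - 1"
    unfolding g_def by (rule golden_ratio_identities)+
  have c: "stochastic_vector c"
    using a r by (rule stochastic_vector_rearrangement)
  define x where "x = partition_point a n"
  have x: "x > 0"
    unfolding x_def by (rule partition_point_pos[OF a])
  have x1: "x < 1"
  proof -
    have "x \<le> partition_point a 1"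
      unfolding x_def using partition_point_antimono[OF a] n by (rule antimonoD)
    moreover have "a 1 > 0" using a by (simp add: stochastic_vector_def)
    ultimately show ?thesis
      using partition_point_Suc[OF a, of 0] partition_point_0[OF a] by simp
  qed
  have "\<exists>m. inverse g * partition_point c m < x \<and> x < g * partition_point c m"
  proof (rule ccontr)
    assume "\<not> ?thesis"
    then have gap: "g * partition_point c m \<le> x" if "inverse g * partition_point c m < x" for m
      using that by (meson not_le)
    have "\<exists>m. g * partition_point c m < x"
      using order_tendstoD(2)[OF tendsto_mult_right_zero[OF partition_point_tendsto_0[OF c]] x]
      by (auto simp: eventually_sequentially)
    then have ex: "\<exists>m. g * partition_point c m \<le> x" by (meson less_imp_le)
    \<comment> \<open>The first point below the window; the point \<open>1\<close> at index \<open>0\<close> lies above \<open>x\<close>.\<close>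
    define m where "m = (LEAST m. g * partition_point c m \<le> x)"
    have below: "g * partition_point c m \<le> x"
      unfolding m_def by (rule LeastI_ex[OF ex])
    have "m \<noteq> 0"
    proof
      assume "m = 0"
      then have "g \<le> x" using below by (simp add: partition_point_0[OF c])
      then show False using x1 g(1) by linarith
    qed
    then obtain j where j: "m = Suc j" by (cases m) auto
    have "\<not> g * partition_point c j \<le> x"
      using not_less_Least[of j "\<lambda>m. g * partition_point c m \<le> x"] j by (simp add: m_def)
    then have above: "x \<le> inverse g * partition_point c j"
      using gap[of j] by linarith
    have "g * x \<le> partition_point c j" "partition_point c m \<le> inverse g * x"
      using above below g(1) by (simp_all add: field_simps)
    then have "c m \<ge> x"
      using partition_point_Suc[OF c, of j] g(2) j by (simp add: algebra_simps)
    then have "partition_point a n \<le> partition_point c m"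
      using entry_less_partition_point[OF a, of n] j
      by (intro partition_point_le_rearranged[OF a r]) (force simp: x_def)+
    then have "g * x \<le> x"
      using below g(1) by (intro order_trans[OF _ below]) (simp add: x_def)
    then show False using x g(1) by simp
  qed
  then show "\<exists>m. inverse ((sqrt 5 + 1) / 2) * partition_point c m < partition_point a n \<and>
      partition_point a n < (sqrt 5 + 1) / 2 * partition_point c m"
    by (simp add: g_def x_def)
qed

section \<open>No smaller constant works\<close>

text \<open>The first entry is \<open>1/\<alpha>\<^sup>2\<close>; the remaining mass \<open>1/\<alpha>\<close> is distributed geometrically with ratio
  \<open>e\<close>, so that for small \<open>e\<close> almost all of it sits in the second entry.\<close>

definition golden_vector :: "real \<Rightarrow> nat \<Rightarrow> real" where
  "golden_vector e n =
     (let g = (sqrt 5 + 1) / 2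
      in if n = 1 then inverse (g\<^sup>2) else inverse g * ((1 - e) * e ^ (n - 2)))"

lemma stochastic_vector_golden_vector:
  assumes e: "0 < e" "e < 1"
  shows "stochastic_vector (golden_vector e)"
proof -
  define g :: real where "g = (sqrt 5 + 1) / 2"
  have g: "g > 1" "inverse (g\<^sup>2) = 1 - inverse g"
    unfolding g_def by (rule golden_ratio_identities)+
  note gv = golden_vector_def Let_def g_def[symmetric]
  have pos: "golden_vector e n > 0" for n
    unfolding gv using e g(1) by auto
  have "(\<lambda>n. inverse g * ((1 - e) * e ^ n)) sums (inverse g * ((1 - e) * (1 / (1 - e))))"
    using e by (intro sums_mult geometric_sums) simp
  then have "(\<lambda>n. golden_vector e (Suc (Suc n))) sums inverse g"
    unfolding gv using e by simp
  then have "(\<lambda>n. golden_vector e (Suc n)) sums (inverse g + golden_vector e 1)"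
    by (subst (asm) sums_Suc_iff) simp
  then have "(\<lambda>n. golden_vector e (Suc n)) sums 1"
    using g(2) by (simp add: gv)
  then have "((\<lambda>n. golden_vector e (Suc n)) has_sum 1) UNIV"
    using pos by (intro sums_nonneg_imp_has_sum) (auto intro: less_imp_le)
  then have "(golden_vector e has_sum 1) {1..}"
    using has_sum_reindex_bij_betw[OF bij_betw_Suc_positive, of "golden_vector e" 1] by simp
  then show ?thesis
    using pos by (simp add: stochastic_vector_def)
qed

lemma entry_le_first_rearranged:
  assumes "nonincreasing_rearrangement a c" "k \<ge> 1"
  shows "a k \<le> c 1"
proof -
  obtain p where p: "bij_betw p {1..} {1..}" and c: "\<And>n. n \<ge> 1 \<Longrightarrow> c n = a (p n)"
    and mono: "antimono_on {1..} c"
    using assms(1) by (auto simp: nonincreasing_rearrangement_def)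
  have "k \<in> p ` {1..}" using p assms(2) by (auto simp: bij_betw_def)
  then obtain j where "j \<ge> 1" "k = p j" by auto
  then show ?thesis using c monotone_onD[OF mono, of 1 j] by simp
qed

lemma golden_ratio_le_rearrangement_constant:
  assumes d: "rearrangement_constant d"
  shows "(sqrt 5 + 1) / 2 \<le> d"
proof (rule ccontr)
  define g :: real where "g = (sqrt 5 + 1) / 2"
  have g: "g > 1" "inverse (g\<^sup>2) = 1 - inverse g"
    unfolding g_def by (rule golden_ratio_identities)+
  note gv = golden_vector_def Let_def g_def[symmetric]
  assume "\<not> ?thesis"
  then have less: "d < g" by (simp add: g_def)
  \<comment> \<open>The bound \<open>1/d - 1/g\<close> gives \<open>d (1/g\<^sup>2 + e/g) \<le> 1/g\<close>; the case \<open>d \<le> 0\<close> is excluded below.\<close>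
  obtain e where e: "0 < e" "e < 1" and de: "d > 0 \<Longrightarrow> e \<le> inverse d - inverse g"
  proof
    let ?e = "if d > 0 then min (1/2) (inverse d - inverse g) else 1/2"
    show "0 < ?e" using less by auto
    show "?e < 1" by auto
    show "?e \<le> inverse d - inverse g" if "d > 0" using that by simp
  qed
  define a where "a = golden_vector e"
  have a: "stochastic_vector a"
    unfolding a_def using e by (rule stochastic_vector_golden_vector)
  obtain c where r: "nonincreasing_rearrangement a c"
    using nonincreasing_rearrangement_exists[OF a] by blast
  have c: "stochastic_vector c"
    using a r by (rule stochastic_vector_rearrangement)
  have a2: "a 2 = inverse g * (1 - e)"
    unfolding a_def gv by simp
  have b1: "partition_point a 1 = inverse g"
    using partition_point_Suc[OF a, of 0] partition_point_0[OF a] g(2) by (simp add: a_def gv)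
  obtain m where m: "inverse d * partition_point c m < inverse g"
      "inverse g < d * partition_point c m"
    using d a r b1 unfolding rearrangement_constant_def by (metis order_refl)
  have d0: "d > 0"
  proof (rule ccontr)
    assume "\<not> d > 0"
    then have "d * partition_point c m \<le> 0"
      using partition_point_nonneg[OF c, of m] by (simp add: mult_nonpos_nonneg)
    moreover have "inverse g > 0" using g(1) by simp
    ultimately show False using m(2) by linarith
  qed
  have "m \<noteq> 0"
  proof
    assume "m = 0"
    then have "inverse d < inverse g" using m(1) by (simp add: partition_point_0[OF c])
    then show False using less d0 by (simp add: inverse_less_iff_less g(1))
  qed
  then have "partition_point c m \<le> partition_point c 1"
    by (intro antimonoD[OF partition_point_antimono[OF c]]) simp
  also have "\<dots> = 1 - c 1"
    using partition_point_Suc[OF c, of 0] by (simp add: partition_point_0[OF c])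
  also have "\<dots> \<le> 1 - a 2"
    using entry_le_first_rearranged[OF r, of 2] by simp
  also have "\<dots> = inverse g * (inverse g + e)"
    unfolding a2 using g(2) by (simp add: power2_eq_square algebra_simps)
  also have "\<dots> \<le> inverse g * inverse d"
    using de[OF d0] g(1) by (intro mult_left_mono) auto
  finally have "d * partition_point c m \<le> d * (inverse g * inverse d)"
    using d0 by (intro mult_left_mono) auto
  also have "\<dots> = inverse g" using d0 by simp
  finally show False using m(2) by simp
qed

theorem theorem2p1:
  shows "rearrangement_constant ((sqrt 5 + 1) / 2) \<and>
         (\<forall>\<delta>. rearrangement_constant \<delta> \<longrightarrow> (sqrt 5 + 1) / 2 \<le> \<delta>)"
  using rearrangement_constant_golden_ratio golden_ratio_le_rearrangement_constant by blast

end
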